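(* For every $i\in\mathbb{Z}_4$, the following relation holds on every nonzero finite-dimensional $\square_q$-module $V$ (i.e. as an equality in $\mathrm{End}(V)$): $$\begin{aligned}\exp_q(\mathfrak{n}_{i,i+1})x_{i+2}\exp_q(\mathfrak{n}_{i,i+1})^{-1}={}&x_{i+2}-x_{i+1}^{-1}+\frac{q\,x_{i+2}x_ix_{i+1}}{q-q^{-1}}-\frac{x_ix_{i+2}x_{i+1}}{q(q-q^{-1})}\\&+\frac{q^3x_{i+2}x_{i}^2x_{i+1}^2}{(q-q^{-1})(q^2-q^{-2})}+\frac{q\,x_i^2x_{i+2}x_{i+1}^2}{(q-q^{-1})(q^2-q^{-2})}-\frac{q^2x_ix_{i+2}x_{i}x_{i+1}^2}{(q-q^{-1})^2}.\end{aligned}$$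
   Context: Let $\mathbb{F}$ be an algebraically closed field and let $0\ne q\in\mathbb{F}$ be not a root of unity. Algebras are associative with $1$. For $n\in\mathbb{Z}$, $[n]_q=(q^n-q^{-n})/(q-q^{-1})$; for $n\in\mathbb{N}=\{0,1,2,\dots\}$, $[n]_q^!=\prod_{k=1}^n[k]_q$ with $[0]_q^!=1$. Let $\mathbb{Z}_4=\mathbb{Z}/4\mathbb{Z}$; indices are taken in $\mathbb{Z}_4$. $\square_q$ is the $\mathbb{F}$-algebra with generators $\{x_i\}_{i\in\mathbb{Z}_4}$ and relations, for $i\in\mathbb{Z}_4$, $$\frac{qx_ix_{i+1}-q^{-1}x_{i+1}x_i}{q-q^{-1}}=1,\qquad x_i^3x_{i+2}-[3]_qx_i^2x_{i+2}x_i+[3]_qx_ix_{i+2}x_i^2-x_{i+2}x_i^3=0.$$ For $i\in\mathbb{Z}_4$ put $\mathfrak{n}_{i,i+1}=\dfrac{q(1-x_ix_{i+1})}{q-q^{-1}}=\dfrac{q^{-1}(1-x_{i+1}x_i)}{q-q^{-1}}\in\square_q$. On every nonzero finite-dimensional $\square_q$-module each $x_i$ acts invertibly, and $x_i^{-1}$ denotes the inverse of that action; each $\mathfrak{n}_{i,i+1}$ acts nilpotently. For a nilpotent $\psi\in\mathrm{End}(V)$, $V$ a nonzero finite-dimensional $\mathbb{F}$-vector space, $\exp_q(\psi)=\sum_{n\in\mathbb{N}}\frac{q^{\binom n2}}{[n]_q^!}\psi^n$, which is invertible. *)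

theory Defs
  imports
    "HOL-Library.Poly_Mapping"
    "HOL-Library.Numeral_Type"
    "HOL-Algebra.Algebraic_Closure_Type"
begin

text \<open>Words form the free monoid, written additively because the convolution product on
  \<^typ>\<open>'a \<Rightarrow>\<^sub>0 'b\<close> expects an additive index monoid.\<close>

instantiation list :: (type) monoid_add
begin

definition zero_list :: "'a list" where "zero_list = []"
definition plus_list :: "'a list \<Rightarrow> 'a list \<Rightarrow> 'a list" where "plus_list xs ys = xs @ ys"

instance by standard (simp_all add: zero_list_def plus_list_def)

end

text \<open>The free associative algebra on generators indexed by $\mathbb{Z}_4$ (the type \<^typ>\<open>4\<close>,
  whose arithmetic is modulo 4): finitely supported functions on words.\<close>

type_synonym 'f free_alg = "4 list \<Rightarrow>\<^sub>0 'f"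

definition free_scalar :: "'f \<Rightarrow> 'f::field free_alg" where
  "free_scalar c = Poly_Mapping.single [] c"

definition free_gen :: "4 \<Rightarrow> 'f::field free_alg" where
  "free_gen i = Poly_Mapping.single [i] 1"

definition qint :: "'f::field \<Rightarrow> int \<Rightarrow> 'f" where
  "qint q n = (q powi n - q powi (- n)) / (q - inverse q)"

definition qfact :: "'f::field \<Rightarrow> nat \<Rightarrow> 'f" where
  "qfact q n = (\<Prod>k = 1..n. qint q (int k))"

definition box_relators :: "'f::field \<Rightarrow> 'f free_alg set" where
  "box_relators q =
     range (\<lambda>i. free_scalar (1 / (q - inverse q)) *
               (free_scalar q * free_gen i * free_gen (i + 1)
                - free_scalar (inverse q) * free_gen (i + 1) * free_gen i) - 1) \<union>
     range (\<lambda>i. free_gen i ^ 3 * free_gen (i + 2)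
               - free_scalar (qint q 3) * free_gen i ^ 2 * free_gen (i + 2) * free_gen i
               + free_scalar (qint q 3) * free_gen i * free_gen (i + 2) * free_gen i ^ 2
               - free_gen (i + 2) * free_gen i ^ 3)"

abbreviation free_ring :: "'f::field free_alg ring" where
  "free_ring \<equiv> ring_of_type_algebra"

lemma ring_free_ring: "ring (free_ring :: 'f::field free_alg ring)"
proof -
  have "\<exists>y. x + y = 0" "\<exists>y. y + x = 0" for x :: "'f free_alg"
    by (rule exI[of _ "- x"], simp)+
  then show ?thesis
    unfolding ring_of_type_algebra_def
    by unfold_locales (auto simp: algebra_simps Units_def)
qed

text \<open>Ideals in HOL-Algebra are two-sided, so this is the algebra presented by the generators and
  the relators.  Its elements are cosets of the ideal.\<close>

definition box_ideal :: "'f::field \<Rightarrow> 'f free_alg set" where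
  "box_ideal q = Idl\<^bsub>free_ring\<^esub> (box_relators q)"

definition box_algebra :: "'f::field \<Rightarrow> 'f free_alg set ring" where
  "box_algebra q = free_ring Quot box_ideal q"

definition box_scalar :: "'f::field \<Rightarrow> 'f \<Rightarrow> 'f free_alg set" where
  "box_scalar q c = box_ideal q +>\<^bsub>free_ring\<^esub> free_scalar c"

definition box_gen :: "'f::field \<Rightarrow> 4 \<Rightarrow> 'f free_alg set" where
  "box_gen q i = box_ideal q +>\<^bsub>free_ring\<^esub> free_gen i"

text \<open>The element $\mathfrak{n}_{i,i+1}$.\<close>

definition box_n :: "'f::field \<Rightarrow> 4 \<Rightarrow> 'f free_alg set" where
  "box_n q i =
     box_scalar q (q / (q - inverse q)) \<otimes>\<^bsub>box_algebra q\<^esub>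
       (\<one>\<^bsub>box_algebra q\<^esub> \<ominus>\<^bsub>box_algebra q\<^esub> box_gen q i \<otimes>\<^bsub>box_algebra q\<^esub> box_gen q (i + 1))"

text \<open>A left module over the algebra: a vector space (the whole type \<^typ>\<open>'v\<close>, with scalar
  multiplication \<open>scale\<close>) together with a unital action \<open>act\<close> that restricts to \<open>scale\<close> on the
  scalars of the algebra.  Linearity of each \<open>act a\<close> over the field follows from \<open>act_mult\<close> and
  \<open>act_scalar\<close>, the scalars being central.\<close>

locale box_module = vector_space scale
  for scale :: "'f::field \<Rightarrow> 'v::ab_group_add \<Rightarrow> 'v" +
  fixes q :: 'f
    and act :: "'f free_alg set \<Rightarrow> 'v \<Rightarrow> 'v"
  assumes act_add_right:
      "a \<in> carrier (box_algebra q) \<Longrightarrow> act a (v + w) = act a v + act a w"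
    and act_add_left:
      "a \<in> carrier (box_algebra q) \<Longrightarrow> b \<in> carrier (box_algebra q) \<Longrightarrow>
        act (a \<oplus>\<^bsub>box_algebra q\<^esub> b) v = act a v + act b v"
    and act_mult:
      "a \<in> carrier (box_algebra q) \<Longrightarrow> b \<in> carrier (box_algebra q) \<Longrightarrow>
        act (a \<otimes>\<^bsub>box_algebra q\<^esub> b) v = act a (act b v)"
    and act_one: "act \<one>\<^bsub>box_algebra q\<^esub> v = v"
    and act_scalar: "act (box_scalar q c) v = scale c v"

text \<open>For nilpotent \<open>\<psi>\<close> only finitely many summands are nonzero, and \<^const>\<open>Sum_any\<close> adds up
  exactly these.  (With infinitely many nonzero summands \<^const>\<open>Sum_any\<close> is 0 by convention.)\<close>

definition qexp :: "'f::field \<Rightarrow> ('f \<Rightarrow> 'v::ab_group_add \<Rightarrow> 'v) \<Rightarrow> ('v \<Rightarrow> 'v) \<Rightarrow> 'v \<Rightarrow> 'v" where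
  "qexp q scale \<psi> v =
     Sum_any (\<lambda>n::nat. scale (q ^ (n choose 2) / qfact q n) ((\<psi> ^^ n) v))"

end

theory Submission
  imports Defs
begin

text \<open>Write \<open>x\<close>, \<open>y\<close>, \<open>z\<close> for the actions of \<open>x\<^sub>i\<close>, \<open>x\<^sub>i\<^sub>+\<^sub>1\<close>, \<open>x\<^sub>i\<^sub>+\<^sub>2\<close>, put
  \<open>p = q\<^sup>2\<close>, \<open>r = 1/p\<close> and \<open>Y = y\<^sup>-\<^sup>1\<close>, and let \<open>n\<close> be the action of the nilpotent element, so that
  \<open>E = exp\<^sub>q(n)\<close>.  Since \<open>E\<close> is bijective, it is enough to find an operator \<open>F\<close> with \<open>E z = F E\<close> and to
  rewrite \<open>F\<close> in terms of \<open>x\<close>, \<open>y\<close>, \<open>z\<close> and \<open>Y\<close>.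

  By the linear relations each of \<open>n\<close>, \<open>x\<close>, \<open>z\<close> scales when moved past \<open>Y\<close>, after a correction by \<open>Y\<close> in two cases:
  \<open>n Y = p Y n\<close>, \<open>x = Y - (p - 1) Y n\<close>, and \<open>z = w + Y\<close> with \<open>w Y = r Y w\<close>.  The cubic relation between
  \<open>x\<close> and \<open>z\<close>, rewritten in \<open>Y\<close>, \<open>n\<close>, \<open>w\<close>, becomes the identity that the third iterated
  \<open>q\<close>-commutator of \<open>n\<close> with \<open>w\<close> equals \<open>\<kappa> Y n\<^sup>2\<close> for an explicit scalar \<open>\<kappa>\<close>.

  If this commutator were zero, conjugation by \<open>E\<close> would turn \<open>w\<close> into
  \<open>w + ad\<^sub>1 + p/(p + 1) ad\<^sub>2\<close>, where \<open>ad\<^sub>1\<close> and \<open>ad\<^sub>2\<close> are the first two iterated \<open>q\<close>-commutators.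
  Instead an infinite tail in \<open>Y n\<^sup>k\<close> appears.  Conjugation of \<open>Y\<close> alone also gives such a
  tail, namely that of \<open>Y (1 - (p - 1) n)\<^sup>-\<^sup>1\<close>.  The value of \<open>\<kappa>\<close> is exactly such that the two tails
  telescope in \<open>E z = E w + E Y\<close>, leaving only \<open>Y + (p - 1) Y n\<close>; this is why the conjugate of \<open>z\<close> is a
  finite expression.  The telescoping is \<open>exp_term_z\<close> for a single term of the exponential and
  \<open>exp_sum_z\<close> for its partial sums.

  Finite dimensionality enters through one observation: if \<open>B A = c A B\<close> with \<open>c\<close> not a
  root of unity, then the polynomials in \<open>A\<close> that annihilate a suitable space are stable under
  \<open>P(T) \<mapsto> P(cT)\<close>, hence contain a power of \<open>T\<close>.  This gives the nilpotency of \<open>n\<close> and the injectivity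
  of \<open>y\<close>.\<close>

section \<open>Operators that scale under commutation\<close>

text \<open>An element \<open>p\<close> of least degree \<open>d\<close> must be a multiple of \<open>T\<^sup>d\<close>: the combination
  \<open>p(cT) - c\<^sup>d p(T)\<close> lies in \<open>I\<close>, has smaller degree and so vanishes, while the powers of \<open>c\<close> are distinct.\<close>

lemma scaling_invariant_poly_space_contains_monom:
  fixes c :: "'f::field" and I :: "'f poly set"
  assumes c: "c \<noteq> 0" "\<And>k::nat. k > 0 \<Longrightarrow> c ^ k \<noteq> 1"
    and ex: "p0 \<in> I" "p0 \<noteq> 0"
    and diff: "\<And>p r. p \<in> I \<Longrightarrow> r \<in> I \<Longrightarrow> p - r \<in> I"
    and smult: "\<And>a p. p \<in> I \<Longrightarrow> smult a p \<in> I"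
    and scaled: "\<And>p. p \<in> I \<Longrightarrow> pcompose p [:0, c:] \<in> I"
  shows "\<exists>d. monom 1 d \<in> I"
proof -
  obtain p where p: "p \<in> I" "p \<noteq> 0"
    and least: "\<And>r. r \<in> I \<Longrightarrow> r \<noteq> 0 \<Longrightarrow> degree p \<le> degree r"
    using ex_has_least_nat[of "\<lambda>p. p \<in> I \<and> p \<noteq> 0" p0 degree] ex by blast
  define d where "d = degree p"
  define r where "r = pcompose p [:0, c:] - smult (c ^ d) p"
  have r: "r \<in> I" unfolding r_def using p by (intro diff scaled smult)
  have cf: "coeff r k = (c ^ k - c ^ d) * coeff p k" for k
    by (simp add: r_def coeff_pcompose_linear algebra_simps)
  have "r = 0"
  proof (rule ccontr)
    assume "r \<noteq> 0"
    have "coeff r k = 0" if "k \<ge> d" for k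
      using that by (cases "k = d") (auto simp: cf d_def coeff_eq_0)
    then have "degree r < d"
      using \<open>r \<noteq> 0\<close> by (metis leading_coeff_0_iff not_le)
    then show False using least[OF r \<open>r \<noteq> 0\<close>] d_def by simp
  qed
  have neq: "c ^ k \<noteq> c ^ d" if "k < d" for k
  proof
    assume "c ^ k = c ^ d"
    moreover have "c ^ k * c ^ (d - k) = c ^ d" using that by (simp flip: power_add)
    ultimately show False using c(1) c(2)[of "d - k"] that by simp
  qed
  have "coeff p k = 0" if "k \<noteq> d" for k
    using \<open>r = 0\<close> cf[of k] neq[of k] that by (cases "k < d") (auto simp: d_def coeff_eq_0)
  then have "smult (1 / lead_coeff p) p = monom 1 d"
    using p by (intro poly_eqI) (auto simp: d_def)
  then show ?thesis using smult[OF p(1)] by metis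
qed

locale linear_operator = vector_space scale
  for scale :: "'f::field \<Rightarrow> 'v::ab_group_add \<Rightarrow> 'v" and A :: "'v \<Rightarrow> 'v" +
  assumes op_add: "A (u + v) = A u + A v" and op_scale: "A (scale c v) = scale c (A v)"
begin

text \<open>The value at \<open>v\<close> of the operator \<open>p(A)\<close>, computed by the Horner scheme so that induction on
  \<open>pCons\<close> applies.\<close>

definition opoly :: "'f poly \<Rightarrow> 'v \<Rightarrow> 'v" where
  "opoly p v = fold_coeffs (\<lambda>a u. scale a v + A u) p 0"

lemma op_0: "A 0 = 0"
  using op_scale[of 0 0] by simp

lemma opoly_0: "opoly 0 v = 0"
  by (simp add: opoly_def)

lemma opoly_pCons: "opoly (pCons a p) v = scale a v + A (opoly p v)"
  by (cases "p = 0 \<and> a = 0") (auto simp: opoly_def op_0)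

lemma opoly_add: "opoly (p + r) v = opoly p v + opoly r v"
  by (induction p r rule: poly_induct2)
     (simp_all add: opoly_0 opoly_pCons op_add scale_left_distrib ac_simps)

lemma opoly_smult: "opoly (smult c p) v = scale c (opoly p v)"
  by (induction p) (simp_all add: opoly_0 opoly_pCons op_scale scale_right_distrib)

lemma opoly_diff: "opoly (p - r) v = opoly p v - opoly r v"
  using opoly_add[of "p - r" r v] by (simp add: algebra_simps)

lemma opoly_mult: "opoly (p * r) v = opoly p (opoly r v)"
  by (induction p) (simp_all add: opoly_0 opoly_pCons opoly_add opoly_smult)

lemma opoly_sum: "opoly (\<Sum>k\<in>K. f k) v = (\<Sum>k\<in>K. opoly (f k) v)"
  by (induction K rule: infinite_finite_induct) (simp_all add: opoly_0 opoly_add)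

lemma opoly_monom: "opoly (monom c k) v = scale c ((A ^^ k) v)"
  by (induction k) (simp_all add: opoly_pCons monom_Suc op_scale monom_0 opoly_0 op_0)

lemma opoly_arg_add: "opoly p (u + v) = opoly p u + opoly p v"
  by (induction p) (simp_all add: opoly_0 opoly_pCons op_add scale_right_distrib ac_simps)

lemma opoly_arg_scale: "opoly p (scale c v) = scale c (opoly p v)"
  by (induction p) (simp_all add: opoly_0 opoly_pCons op_scale scale_right_distrib mult.commute)

text \<open>The relation \<open>B A = c A B\<close> extends from \<open>A\<close> to its polynomials as \<open>B p(A) = p(cA) B\<close>.\<close>

lemma opoly_scaled_intertwine:
  assumes B_add: "\<And>u v. B (u + v) = B u + B v" and B_scale: "\<And>c v. B (scale c v) = scale c (B v)"
    and BA: "\<And>v. B (A v) = scale c (A (B v))"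
  shows "B (opoly p v) = opoly (pcompose p [:0, c:]) (B v)"
proof (induction p)
  case 0
  show ?case using B_scale[of 0 0] by (simp add: opoly_0)
next
  case (pCons a p)
  then show ?case
    by (simp add: opoly_pCons opoly_0 op_0 opoly_smult opoly_add pcompose_pCons B_add B_scale BA op_scale)
qed

end

locale finite_dim_operator = finite_dimensional_vector_space scale Basis + linear_operator scale A
  for scale :: "'f::field \<Rightarrow> 'v::ab_group_add \<Rightarrow> 'v" and Basis A
begin

text \<open>Otherwise the vectors \<open>A\<^sup>k v\<close> would be an infinite independent family.\<close>

lemma vector_annihilator_exists: "\<exists>p. p \<noteq> 0 \<and> opoly p v = 0"
proof (rule ccontr)
  assume "\<not> ?thesis"
  then have nz: "opoly p v \<noteq> 0" if "p \<noteq> 0" for p using that by blast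
  define g where "g = (\<lambda>k. (A ^^ k) v)"
  have inj: "inj g"
  proof (rule injI)
    fix j k assume "g j = g k"
    then have "opoly (monom 1 j - monom 1 k) v = 0"
      by (simp add: opoly_diff opoly_monom g_def)
    then have "monom (1::'f) j = monom 1 k"
      using nz[of "monom 1 j - monom 1 k"] by (metis right_minus_eq)
    then show "j = k" using degree_monom_eq[of "1::'f"] by (metis one_neq_zero)
  qed
  have "independent (range g)"
  proof
    assume "dependent (range g)"
    then obtain T u where T: "finite T" "T \<subseteq> range g" "(\<Sum>t\<in>T. scale (u t) t) = 0"
      and u: "\<exists>t\<in>T. u t \<noteq> 0"
      unfolding dependent_explicit by blast
    obtain K where K: "finite K" "T = g ` K"
      using T finite_subset_image by metis
    define p where "p = (\<Sum>k\<in>K. monom (u (g k)) k)"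
    have "opoly p v = (\<Sum>k\<in>K. scale (u (g k)) (g k))"
      by (simp add: p_def opoly_sum opoly_monom g_def)
    also have "\<dots> = 0"
      using T(3) inj by (simp add: K sum.reindex inj_on_subset)
    finally have "p = 0" using nz by blast
    moreover have "coeff p k = u (g k)" if "k \<in> K" for k
      using that K by (simp add: p_def coeff_sum)
    ultimately show False using u K by auto
  qed
  then have "finite (range g)" by (rule finiteI_independent)
  then show False using inj finite_imageD infinite_UNIV_nat by blast
qed

text \<open>A product of polynomials that annihilate the individual basis vectors annihilates the whole space.\<close>

lemma annihilator_exists: "\<exists>p. p \<noteq> 0 \<and> (\<forall>v. opoly p v = 0)"
proof -
  have "\<exists>p. p \<noteq> 0 \<and> (\<forall>v\<in>S. opoly p v = 0)" if "finite S" for S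
    using that
  proof induction
    case empty
    show ?case by (rule exI[of _ 1]) simp
  next
    case (insert b S)
    then obtain p where p: "p \<noteq> 0" "\<forall>v\<in>S. opoly p v = 0" by blast
    obtain r where r: "r \<noteq> 0" "opoly r b = 0" using vector_annihilator_exists by blast
    have z: "opoly s 0 = 0" for s using opoly_arg_scale[of s 0 0] by simp
    have "opoly (p * r) b = 0" by (simp add: opoly_mult r z)
    moreover have "\<forall>v\<in>S. opoly (p * r) v = 0"
      using p by (simp add: mult.commute[of p] opoly_mult z)
    ultimately show ?case using p r by (intro exI[of _ "p * r"]) auto
  qed
  then obtain p where p: "p \<noteq> 0" "\<forall>v\<in>Basis. opoly p v = 0"
    using finite_Basis by blast
  have "opoly p v = 0" for v
  proof -
    have "v \<in> span Basis" using span_Basis by simp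
    then show ?thesis
    proof (induction rule: span_induct_alt)
      case base
      show ?case using opoly_arg_scale[of p 0 0] by simp
    next
      case (step c u v)
      then show ?case using p by (simp add: opoly_arg_add opoly_arg_scale)
    qed
  qed
  then show ?thesis using p by blast
qed

text \<open>The annihilating polynomials of \<open>A\<close> are stable under \<open>p(T) \<mapsto> p(cT)\<close> because \<open>B\<close> is onto, and so
  they contain a power of \<open>T\<close>.\<close>

lemma nilpotent_if_conjugate_to_multiple:
  assumes c: "c \<noteq> 0" "\<And>k::nat. k > 0 \<Longrightarrow> c ^ k \<noteq> 1"
    and B_add: "\<And>u v. B (u + v) = B u + B v" and B_scale: "\<And>c v. B (scale c v) = scale c (B v)"
    and BA: "\<And>v. B (A v) = scale c (A (B v))" and surj: "surj B"
  shows "\<exists>d. \<forall>v. (A ^^ d) v = 0"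
proof -
  obtain p0 where p0: "p0 \<noteq> 0" "\<forall>v. opoly p0 v = 0"
    using annihilator_exists by blast
  have "\<exists>d. monom 1 d \<in> {p. \<forall>v. opoly p v = 0}"
  proof (rule scaling_invariant_poly_space_contains_monom[OF c, of p0])
    fix p assume p: "p \<in> {p. \<forall>v. opoly p v = 0}"
    have "opoly (pcompose p [:0, c:]) v = 0" for v
    proof -
      obtain u where "v = B u" using surj by blast
      then show ?thesis
        using opoly_scaled_intertwine[of B c p u, OF B_add B_scale BA] p B_scale[of 0 0] by simp
    qed
    then show "pcompose p [:0, c:] \<in> {p. \<forall>v. opoly p v = 0}" by simp
  qed (use p0 in \<open>auto simp: opoly_diff opoly_smult\<close>)
  then show ?thesis by (simp add: opoly_monom)
qed

text \<open>The vectors \<open>A\<^sup>k v\<close> are eigenvectors of \<open>B\<close> for the distinct values \<open>c\<^sup>k l\<close>, as long as they are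
  not zero, so only finitely many of them can be nonzero.  The proof uses stability of the polynomials that
  annihilate \<open>v\<close>, which avoids a separate independence argument for eigenvectors.\<close>

lemma eigenvector_orbit_terminates:
  assumes c: "c \<noteq> 0" "\<And>k::nat. k > 0 \<Longrightarrow> c ^ k \<noteq> 1"
    and B_add: "\<And>u v. B (u + v) = B u + B v" and B_scale: "\<And>c v. B (scale c v) = scale c (B v)"
    and BA: "\<And>v. B (A v) = scale c (A (B v))"
    and eig: "B v = scale l v" "l \<noteq> 0"
  shows "\<exists>d. (A ^^ d) v = 0"
proof -
  obtain p0 where p0: "p0 \<noteq> 0" "opoly p0 v = 0"
    using vector_annihilator_exists by blast
  have "\<exists>d. monom 1 d \<in> {p. opoly p v = 0}"
  proof (rule scaling_invariant_poly_space_contains_monom[OF c, of p0])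
    fix p assume p: "p \<in> {p. opoly p v = 0}"
    have "scale l (opoly (pcompose p [:0, c:]) v) = 0"
      using opoly_scaled_intertwine[of B c p v, OF B_add B_scale BA] p B_scale[of 0 0]
      by (simp add: eig opoly_arg_scale)
    then show "pcompose p [:0, c:] \<in> {p. opoly p v = 0}" using eig by simp
  qed (use p0 in \<open>auto simp: opoly_diff opoly_smult\<close>)
  then show ?thesis by (simp add: opoly_monom)
qed

end

section \<open>The linear relation between neighbouring generators\<close>

text \<open>All identities below have coefficients in \<open>p = q\<^sup>2\<close> only.  The inverse \<open>r\<close> is a parameter of its own so that
  the simplifier can treat coefficients as monomials in \<open>p\<close> and \<open>r\<close>, cancelled by \<open>p r = 1\<close>.\<close>

locale q_scalars = vector_space scale
  for scale :: "'f::field \<Rightarrow> 'v::ab_group_add \<Rightarrow> 'v" +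
  fixes p r :: 'f
  assumes p_nonzero: "p \<noteq> 0" and p_not_root_of_unity: "\<And>k::nat. k > 0 \<Longrightarrow> p ^ k \<noteq> 1"
    and r: "p * r = 1"
begin

lemma p_1: "p - 1 \<noteq> 0"
  using p_not_root_of_unity[of 1] by simp

lemma r_eq: "r = 1 / p"
  using r p_nonzero by (simp add: field_simps)

lemma pr: "p * r = 1" "p * (r * a) = a"
  using r by (simp_all flip: mult.assoc)

lemma p_plus_1: "p + 1 \<noteq> 0"
proof
  assume "p + 1 = 0"
  then have "(p - 1) * (p + 1) = 0" by simp
  then have "p ^ 2 = 1" by (simp add: algebra_simps power2_eq_square)
  then show False using p_not_root_of_unity[of 2] by simp
qed

lemma additive_diff:
  fixes f :: "'v \<Rightarrow> 'v"
  assumes "\<And>u v. f (u + v) = f u + f v"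
  shows "f (u - v) = f u - f v"
  using assms[of "u - v" v] by (simp add: algebra_simps)

lemmas scale_distribs =
  scale_right_distrib scale_right_diff_distrib scale_left_distrib scale_left_diff_distrib

text \<open>Used to split integer multiples into repeated summands, after which two equal linear combinations
  of vectors agree up to the order of the summands.\<close>

lemma numeral_multiples: "(a::'f) * 2 = a + a" "(a::'f) * 3 = a + a + a"
  using distrib_left[of a 1 1] distrib_left[of a 2 1] by simp_all

text \<open>In terms of \<open>q\<close> this is \<open>(1 - q\<^sup>2) (1 - q\<^sup>-\<^sup>4) [3]\<^sub>q\<close>.\<close>

definition \<kappa> :: 'f where "\<kappa> = - (p - 1) * (1 - r * r) * (p + 1 + r)"

end

text \<open>The assumption \<open>x_y\<close> is the relation \<open>(q x y - q\<^sup>-\<^sup>1 y x) / (q - q\<^sup>-\<^sup>1) = 1\<close> solved for \<open>x y\<close>, and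
  \<open>n\<close> is the element whose \<open>q\<close>-exponential is studied: \<open>q / (q - q\<^sup>-\<^sup>1) = p / (p - 1)\<close>.\<close>

locale q_weyl_pair = q_scalars scale p r
  for scale :: "'f::field \<Rightarrow> 'v::ab_group_add \<Rightarrow> 'v" and p r +
  fixes x y :: "'v \<Rightarrow> 'v"
  assumes x_add: "x (u + v) = x u + x v" and x_scale: "x (scale c v) = scale c (x v)"
    and y_add: "y (u + v) = y u + y v" and y_scale: "y (scale c v) = scale c (y v)"
    and x_y: "x (y v) = scale r (y (x v)) + scale (1 - r) v"
begin

lemmas x_diff = additive_diff[of x, OF x_add]
lemmas y_diff = additive_diff[of y, OF y_add]

definition n where "n v = scale (p / (p - 1)) (v - x (y v))"

lemma n_add: "n (u + v) = n u + n v"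
  by (simp add: n_def x_add y_add scale_right_distrib scale_right_diff_distrib)

lemma n_scale: "n (scale c v) = scale c (n v)"
  by (simp add: n_def x_scale y_scale scale_right_diff_distrib mult.commute)

lemmas n_diff = additive_diff[of n, OF n_add]

lemma xy_n: "x (y v) = v - scale (1 - r) (n v)"
  using p_1 p_nonzero by (simp add: n_def r_eq field_simps scale_distribs)

lemma yx_n: "y (x v) = v - scale (p - 1) (n v)"
proof -
  have "scale p (x (y v)) = y (x v) + scale (p - 1) v"
    by (simp add: x_y scale_distribs pr algebra_simps)
  then have "y (x v) = scale p (x (y v)) - scale (p - 1) v" by simp
  also have "\<dots> = v - scale (p - 1) (n v)"
    by (simp add: xy_n scale_distribs pr algebra_simps)
  finally show ?thesis .
qed

text \<open>Evaluate \<open>y x y\<close> in two ways, using that \<open>x y\<close> and \<open>y x\<close> are both affine functions of \<open>n\<close>; the analogous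
  evaluation of \<open>x y x\<close> gives \<open>n_x\<close>.\<close>

lemma y_n: "y (n v) = scale p (n (y v))"
proof -
  have "y (v - scale (1 - r) (n v)) = y v - scale (p - 1) (n (y v))"
    using yx_n[of "y v"] by (simp only: xy_n)
  then have "scale (1 - r) (y (n v)) = scale (p - 1) (n (y v))"
    by (simp add: y_diff y_scale)
  then have "scale p (scale (1 - r) (y (n v))) = scale p (scale (p - 1) (n (y v)))" by simp
  then have "scale (p - 1) (y (n v)) = scale (p - 1) (scale p (n (y v)))"
    by (simp add: right_diff_distrib r mult.commute)
  then show ?thesis using p_1 by (simp flip: scale_scale)
qed

lemma n_y: "n (y v) = scale r (y (n v))"
  by (simp add: y_n mult.commute r)

lemma n_x: "n (x v) = scale p (x (n v))"
proof -
  have "x v - scale (1 - r) (n (x v)) = x (v - scale (p - 1) (n v))"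
    using xy_n[of "x v"] by (simp only: yx_n)
  then have "scale p (scale (1 - r) (n (x v))) = scale p (scale (p - 1) (x (n v)))"
    by (simp add: x_diff x_scale)
  then have "scale (p - 1) (n (x v)) = scale (p - 1) (scale p (x (n v)))"
    by (simp add: right_diff_distrib r mult.commute)
  then show ?thesis using p_1 by (simp flip: scale_scale)
qed

text \<open>A vector \<open>v\<close> killed by \<open>y\<close> is an eigenvector of \<open>n\<close>, and \<open>x\<close> multiplies \<open>n\<close>-eigenvalues by \<open>p\<close>.
  In finite dimension the sequence \<open>x\<^sup>k v\<close> must reach zero, but its last nonzero member \<open>u\<close> satisfies
  \<open>x u = 0\<close>, which prescribes a second value of the eigenvalue and forces \<open>p\<close> to be a root of unity.\<close>

lemma y_kernel_trivial:
  assumes fd: "finite_dimensional_vector_space scale Basis" and yv: "y v = 0"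
  shows "v = 0"
proof (rule ccontr)
  assume v: "v \<noteq> 0"
  interpret fx: finite_dim_operator scale Basis x
    by (intro finite_dim_operator.intro fd linear_operator.intro vector_space_axioms
        linear_operator_axioms.intro x_add x_scale)
  define l where "l = p / (p - 1)"
  have x0: "x 0 = 0" using x_scale[of 0 0] by simp
  have nv: "n v = scale l v" by (simp add: n_def l_def yv x0)
  have "\<exists>d. (x ^^ d) v = 0"
    by (rule fx.eigenvector_orbit_terminates[where c = p and B = n and l = l])
       (use p_nonzero p_1 nv in \<open>simp_all add: l_def p_not_root_of_unity n_add n_scale n_x\<close>)
  then obtain d where d: "(x ^^ d) v = 0" "\<And>k. k < d \<Longrightarrow> (x ^^ k) v \<noteq> 0"
    using exists_least_iff[of "\<lambda>d. (x ^^ d) v = 0"] by blast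
  obtain k where k: "d = Suc k" using d v by (cases d) auto
  define u where "u = (x ^^ k) v"
  have u: "u \<noteq> 0" "x u = 0" using d k by (simp_all add: u_def)
  have "n ((x ^^ j) v) = scale (p ^ j * l) ((x ^^ j) v)" for j
    by (induction j) (simp_all add: nv n_x x_scale ac_simps)
  then have nu: "n u = scale (p ^ k * l) u" by (simp add: u_def)
  have "y 0 = 0" using y_scale[of 0 0] by simp
  then have "u = scale (p - 1) (n u)" using yx_n[of u] u by simp
  also have "\<dots> = scale (p ^ Suc k) u" using p_1 by (simp add: nu l_def)
  finally have "scale (p ^ Suc k - 1) u = 0" by (simp add: scale_left_diff_distrib)
  then show False using u p_not_root_of_unity[of "Suc k"] by simp
qed

lemma y_bij:
  assumes fd: "finite_dimensional_vector_space scale Basis"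
  shows "bij y"
proof -
  interpret fd: finite_dimensional_vector_space scale Basis by (rule fd)
  have lin: "Vector_Spaces.linear scale scale y"
    by unfold_locales (rule y_add y_scale)+
  have "inj y"
    using y_kernel_trivial[OF fd] y_diff by (metis injI right_minus_eq)
  then show ?thesis
    using fd.linear_inj_imp_surj[OF lin] by (simp add: bij_def)
qed

lemma n_nilpotent:
  assumes fd: "finite_dimensional_vector_space scale Basis"
  shows "\<exists>N. \<forall>v. (n ^^ N) v = 0"
proof -
  interpret fn: finite_dim_operator scale Basis n
    by (intro finite_dim_operator.intro fd linear_operator.intro vector_space_axioms
        linear_operator_axioms.intro n_add n_scale)
  show ?thesis
    by (rule fn.nilpotent_if_conjugate_to_multiple[where c = p and B = y])
       (simp_all add: p_nonzero p_not_root_of_unity y_add y_scale y_n bij_is_surj[OF y_bij[OF fd]])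
qed

end

section \<open>Conjugation by the exponential\<close>

text \<open>The left side of \<open>serre\<close> is the product of the three commuting factors
  \<open>L - R\<close>, \<open>L - r R\<close>, \<open>L - r\<^sup>2 R\<close> applied to \<open>w\<close>, where \<open>L\<close> and \<open>R\<close> are left and right multiplication by \<open>n\<close>;
  \<open>ad1\<close> and \<open>ad2\<close> below are the results of the first one and of the first two.\<close>

locale q_serre_pair = q_scalars scale p r
  for scale :: "'f::field \<Rightarrow> 'v::ab_group_add \<Rightarrow> 'v" and p r +
  fixes n w Y :: "'v \<Rightarrow> 'v"
  assumes n_add: "n (u + v) = n u + n v" and n_scale: "n (scale c v) = scale c (n v)"
    and w_add: "w (u + v) = w u + w v" and w_scale: "w (scale c v) = scale c (w v)"
    and Y_add: "Y (u + v) = Y u + Y v" and Y_scale: "Y (scale c v) = scale c (Y v)"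
    and n_Y: "n (Y v) = scale p (Y (n v))"
    and serre: "n (n (n (w v))) - scale (1 + r + r * r) (n (n (w (n v))))
      + scale (r + r * r + r * (r * r)) (n (w (n (n v)))) - scale (r * (r * r)) (w (n (n (n v))))
      = scale \<kappa> (Y (n (n v)))"
begin

lemmas n_diff = additive_diff[of n, OF n_add]
lemmas w_diff = additive_diff[of w, OF w_add]
lemmas Y_diff = additive_diff[of Y, OF Y_add]

definition ad1 where "ad1 v = n (w v) - w (n v)"
definition ad2 where "ad2 v = n (ad1 v) - scale r (ad1 (n v))"

lemma ad1_add: "ad1 (u + v) = ad1 u + ad1 v"
  by (simp add: ad1_def n_add w_add)

lemma ad1_scale: "ad1 (scale c v) = scale c (ad1 v)"
  by (simp add: ad1_def n_scale w_scale scale_right_diff_distrib)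

lemma ad2_add: "ad2 (u + v) = ad2 u + ad2 v"
  by (simp add: ad2_def n_add ad1_add scale_right_distrib)

lemma ad2_scale: "ad2 (scale c v) = scale c (ad2 v)"
  by (simp add: ad2_def n_scale ad1_scale scale_right_diff_distrib mult.commute)

lemma n_w: "n (w v) = w (n v) + ad1 v"
  by (simp add: ad1_def)

lemma n_ad1: "n (ad1 v) = scale r (ad1 (n v)) + ad2 v"
  by (simp add: ad2_def)

lemma n_ad2: "n (ad2 v) = scale (r * r) (ad2 (n v)) + scale \<kappa> (Y (n (n v)))"
  unfolding serre [of v, symmetric]
  by (simp add: ad2_def ad1_def n_add n_diff n_scale w_add w_diff scale_distribs algebra_simps)

text \<open>The coefficients \<open>q\<^bsup>m(m-1)/2\<^esup> / [m]\<^sub>q!\<close> of the \<open>q\<close>-exponential; the ratio of two consecutive ones,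
  \<open>q\<^bsup>m\<^esup> / [m + 1]\<^sub>q\<close>, is a rational function of \<open>p\<close>.\<close>

primrec exp_coeff :: "nat \<Rightarrow> 'f" where
  "exp_coeff 0 = 1"
| "exp_coeff (Suc m) = (p - 1) * p ^ m / (p ^ Suc m - 1) * exp_coeff m"

definition exp_term where "exp_term m v = scale (exp_coeff m) ((n ^^ m) v)"

lemma exp_term_0: "exp_term 0 v = v"
  by (simp add: exp_term_def)

lemma exp_term_Suc: "exp_term (Suc m) v = scale ((p - 1) * p ^ m / (p ^ Suc m - 1)) (n (exp_term m v))"
  by (simp add: exp_term_def n_scale)

lemma exp_term_1: "exp_term (Suc 0) v = n v"
  using p_1 by (simp add: exp_term_Suc exp_term_0)

text \<open>This is the coefficient of \<open>n\<^sup>2\<close> in the exponential.\<close>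

definition c2 where "c2 = p / (p + 1)"

text \<open>Moving the powers of \<open>n\<close> to the right of \<open>w\<close> by \<open>n_w\<close>, \<open>n_ad1\<close>, \<open>n_ad2\<close> produces \<open>q\<close>-binomial
  coefficients, which combine with the exponential coefficient of index \<open>m + 2\<close> into those of index
  \<open>m + 1\<close> for \<open>ad1\<close> and \<open>m\<close> for \<open>ad2\<close>.  All other terms lie in the span of the \<open>Y n\<^sup>k\<close>: the power of \<open>p\<close> from
  moving \<open>n\<close> past \<open>Y\<close>, and the contributions of \<open>\<kappa>\<close>.  They are grouped so that the parts which do not
  involve a fixed operator applied to a term of the exponential form a difference of consecutive
  members of one sequence, and therefore telescope on summation.\<close>

lemma exp_term_z:
  "exp_term (Suc (Suc m)) (w v + Y v) =
     w (exp_term (Suc (Suc m)) v) + ad1 (exp_term (Suc m) v) + scale c2 (ad2 (exp_term m v))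
     + Y (scale (p ^ Suc (Suc m)) (exp_term (Suc (Suc m)) v) - scale (p ^ Suc m) (exp_term (Suc m) v)
          + exp_term (Suc m) v + scale (p - 1) (n (exp_term m v)))"
proof (induction m)
  case 0
  have e2: "exp_term (Suc (Suc 0)) u = scale c2 (n (n u))" for u
  proof -
    have "(p - 1) * p / (p * p - 1) = c2"
      using p_1 p_plus_1 p_not_root_of_unity[of 2]
      by (simp add: c2_def divide_simps power2_eq_square) (simp add: algebra_simps)
    then show ?thesis by (simp add: exp_term_Suc[of "Suc 0"] exp_term_1)
  qed
  have a: "c2 + c2 * r = 1" using p_plus_1 p_nonzero by (simp add: c2_def r_eq field_simps)
  have "n (n (w v + Y v)) = w (n (n v)) + ad1 (n v) + scale r (ad1 (n v)) + ad2 v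
      + scale (p * p) (Y (n (n v)))"
    by (simp add: n_add n_w n_ad1 n_Y n_scale ac_simps)
  moreover have "scale c2 (ad1 (n v)) + scale (c2 * r) (ad1 (n v)) = ad1 (n v)"
    using a by (metis scale_left_distrib scale_one)
  ultimately show ?case
    by (simp add: e2 exp_term_1 exp_term_0 scale_distribs w_scale ad1_scale Y_scale Y_add Y_diff algebra_simps)
next
  case (Suc m)
  \<comment> \<open>\<open>a\<close>, \<open>b\<close>, \<open>c\<close> are the three successive coefficient ratios of the exponential from index \<open>m\<close> on.\<close>
  define u where "u = exp_term m v"
  define P where "P = p ^ m"
  define a where "a = (p - 1) * P / (p * P - 1)"
  define b where "b = (p - 1) * (p * P) / (p * (p * P) - 1)"
  define c where "c = (p - 1) * (p * (p * P)) / (p * (p * (p * P)) - 1)"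
  have D: "p * P - 1 \<noteq> 0" "p * (p * P) - 1 \<noteq> 0" "p * (p * (p * P)) - 1 \<noteq> 0"
    using p_not_root_of_unity[of "Suc m"] p_not_root_of_unity[of "Suc (Suc m)"]
      p_not_root_of_unity[of "Suc (Suc (Suc m))"] by (simp_all add: P_def)
  have e1: "exp_term (Suc m) v = scale a (n u)"
    by (simp add: exp_term_Suc[of m] u_def a_def P_def)
  have e2: "exp_term (Suc (Suc m)) v = scale (b * a) (n (n u))"
    by (simp add: exp_term_Suc[of "Suc m"] e1 n_scale b_def P_def)
  have e3: "exp_term (Suc (Suc (Suc m))) v = scale (c * (b * a)) (n (n (n u)))"
    by (simp add: exp_term_Suc[of "Suc (Suc m)"] e2 n_scale c_def P_def)
  \<comment> \<open>After one more application of \<open>n\<close> the coefficients of \<open>ad1\<close>, \<open>ad2\<close> and \<open>Y\<close> have to agree; the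
    last of these three identities is where the exact value of \<open>\<kappa>\<close> matters.\<close>
  have coeff_ad1: "c * (b * a + a * r) = b * a"
    using D p_nonzero p_1 by (simp add: a_def b_def c_def r_eq divide_simps) (simp add: algebra_simps)
  have coeff_ad2: "c * (a + c2 * (r * r)) = c2 * a"
    using D p_nonzero p_1 p_plus_1
    by (simp add: a_def c_def c2_def r_eq divide_simps) (simp add: algebra_simps)
  have coeff_Y: "c * (c2 * \<kappa> + p * (a - p * P * a + (p - 1)))
      = b * a - p * (p * P) * (b * a) + (p - 1) * a"
    unfolding \<kappa>_def using D p_nonzero p_1 p_plus_1
    by (simp add: a_def b_def c_def c2_def r_eq divide_simps) (simp add: algebra_simps)
  have "exp_term (Suc (Suc (Suc m))) (w v + Y v) = scale c (n (exp_term (Suc (Suc m)) (w v + Y v)))"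
    by (simp add: exp_term_Suc[of "Suc (Suc m)"] c_def P_def)
  also have "\<dots> = w (exp_term (Suc (Suc (Suc m))) v) + scale (c * (b * a + a * r)) (ad1 (n (n u)))
     + scale (c * (a + c2 * (r * r))) (ad2 (n u))
     + Y (scale (p ^ Suc (Suc (Suc m))) (exp_term (Suc (Suc (Suc m))) v)
        + scale (c * (c2 * \<kappa> + p * (a - p * P * a + (p - 1)))) (n (n u)))"
    unfolding Suc.IH e1 e2 e3 u_def[symmetric]
    by (simp add: n_add n_diff n_scale n_w n_ad1 n_ad2 n_Y w_scale ad1_scale ad2_scale Y_add Y_diff Y_scale
        scale_distribs P_def[symmetric] algebra_simps)
  also have "\<dots> = w (exp_term (Suc (Suc (Suc m))) v) + ad1 (exp_term (Suc (Suc m)) v)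
     + scale c2 (ad2 (exp_term (Suc m) v))
     + Y (scale (p ^ Suc (Suc (Suc m))) (exp_term (Suc (Suc (Suc m))) v)
          - scale (p ^ Suc (Suc m)) (exp_term (Suc (Suc m)) v)
          + exp_term (Suc (Suc m)) v + scale (p - 1) (n (exp_term (Suc m) v)))"
    unfolding coeff_ad1 coeff_ad2 coeff_Y
    by (simp add: e1 e2 n_scale ad1_scale ad2_scale Y_add Y_diff Y_scale scale_distribs
        P_def[symmetric] algebra_simps)
  finally show ?case .
qed

definition exp_sum where "exp_sum M v = (\<Sum>m<M. exp_term m v)"

text \<open>The operator \<open>F\<close> with \<open>E z = F E\<close> for \<open>z = w + Y\<close>.\<close>

definition conj_z where "conj_z v = w v + ad1 v + scale c2 (ad2 v) + Y (v + scale (p - 1) (n v))"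

lemma exp_sum_Suc: "exp_sum (Suc M) v = exp_sum M v + exp_term M v"
  by (simp add: exp_sum_def)

text \<open>The only term that does not fit the form of \<open>conj_z\<close> is the end of the telescoping sum,
  \<open>p\<^bsup>M+1\<^esup>\<close> times the exponential term of index \<open>M + 1\<close>, and it vanishes for large \<open>M\<close>.\<close>

lemma exp_sum_z:
  "exp_sum (Suc (Suc M)) (w v + Y v) =
     w (exp_sum (Suc (Suc M)) v) + ad1 (exp_sum (Suc M) v) + scale c2 (ad2 (exp_sum M v))
     + Y (scale (p ^ Suc M) (exp_term (Suc M) v) + exp_sum (Suc M) v
          + scale (p - 1) (n (exp_sum M v)))"
proof (induction M)
  case 0
  show ?case
    by (simp add: exp_sum_def exp_term_0 exp_term_1 n_add n_w n_Y w_add ad2_scale[of 0 0, simplified]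
        n_scale[of 0 0, simplified] Y_add Y_scale ac_simps)
next
  case (Suc M)
  have "exp_sum (Suc (Suc (Suc M))) (w v + Y v)
      = exp_sum (Suc (Suc M)) (w v + Y v) + exp_term (Suc (Suc M)) (w v + Y v)"
    by (rule exp_sum_Suc)
  then show ?case
    unfolding Suc.IH exp_term_z exp_sum_Suc[of "Suc (Suc M)" v] exp_sum_Suc[of "Suc M" v]
      exp_sum_Suc[of "M" v]
    by (simp add: w_add ad1_add ad2_add n_add Y_add Y_diff Y_scale scale_distribs algebra_simps)
qed

context
  fixes N assumes nilpotent: "\<And>v. (n ^^ N) v = 0"
begin

lemma n_0: "n 0 = 0"
  using n_scale[of 0 0] by simp

lemma n_funpow_0: "(n ^^ k) 0 = 0"
  by (induction k) (simp_all add: n_0)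

lemma exp_term_eq_0: "M \<ge> N \<Longrightarrow> exp_term M v = 0"
proof -
  assume "M \<ge> N"
  then show "exp_term M v = 0"
    using \<open>M \<ge> N\<close> nilpotent funpow_add[of "M - N" N n]
    by (simp add: exp_term_def n_funpow_0)
qed

lemma exp_sum_stable: "M \<ge> N \<Longrightarrow> exp_sum M v = exp_sum N v"
proof (induction M rule: dec_induct)
  case base
  show ?case ..
next
  case (step M)
  show ?case using step.IH exp_term_eq_0[OF step.hyps(1)] by (simp only: exp_sum_Suc add_0_right)
qed

lemma n_funpow_add: "(n ^^ k) (u + v) = (n ^^ k) u + (n ^^ k) v"
  by (induction k) (simp_all add: n_add)

lemma n_funpow_scale: "(n ^^ k) (scale c v) = scale c ((n ^^ k) v)"
  by (induction k) (simp_all add: n_scale)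

text \<open>The exponential is the identity plus higher powers of \<open>n\<close>, so it does not change the last
  nonzero vector among the \<open>n\<^sup>k v\<close>.\<close>

lemma exp_sum_kernel_trivial:
  assumes "exp_sum N v = 0"
  shows "v = 0"
proof (rule ccontr)
  assume v: "v \<noteq> 0"
  obtain d where d: "(n ^^ d) v = 0" "\<And>k. k < d \<Longrightarrow> (n ^^ k) v \<noteq> 0"
    using exists_least_iff[of "\<lambda>d. (n ^^ d) v = 0"] nilpotent[of v] by blast
  obtain k where k: "d = Suc k" using d v by (cases d) auto
  have killed: "(n ^^ k) (exp_term (Suc m) v) = 0" for m
  proof -
    have "(n ^^ k) ((n ^^ Suc m) v) = (n ^^ m) ((n ^^ d) v)"
      by (simp add: k flip: funpow_add comp_apply[of "n ^^ _" "n ^^ _"] funpow.simps(2))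
         (simp add: add.commute)
    then show ?thesis by (simp add: exp_term_def n_funpow_scale d n_funpow_0)
  qed
  have "(n ^^ k) (exp_sum (Suc M) v) = (n ^^ k) v" for M
    by (induction M)
       (simp_all add: exp_sum_Suc[of "Suc _"] n_funpow_add killed, simp add: exp_sum_def exp_term_0)
  from this[of N] have "(n ^^ k) v = (n ^^ k) 0"
    using exp_sum_stable[of "Suc N" v] assms by simp
  then show False using d k by (simp add: n_funpow_0)
qed

lemma qexp_eq_exp_sum:
  assumes "q \<noteq> 0" "p = q ^ 2"
  shows "qexp q scale n v = exp_sum N v"
proof -
  have qint: "q ^ m / qint q (int (Suc m)) = (p - 1) * p ^ m / (p ^ Suc m - 1)" for m
  proof -
    have "p ^ Suc m - 1 \<noteq> 0" using p_not_root_of_unity[of "Suc m"] by simp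
    moreover have "q ^ m * (q - inverse q) * (q ^ Suc m) = (p - 1) * p ^ m"
      using assms(1) by (simp add: assms(2) field_simps power_mult_distrib power2_eq_square)
    moreover have "(q ^ Suc m - inverse (q ^ Suc m)) * q ^ Suc m = p ^ Suc m - 1"
    proof -
      have "q ^ Suc m * q ^ Suc m = p ^ Suc m"
        by (simp only: assms(2) power2_eq_square power_mult_distrib)
      moreover have "(a - inverse a) * a = a * a - 1" if "a \<noteq> 0" for a :: 'f
        using that by (simp add: left_diff_distrib)
      ultimately show ?thesis using assms(1) by (metis power_not_zero)
    qed
    moreover have "qint q (int (Suc m)) = (q ^ Suc m - inverse (q ^ Suc m)) / (q - inverse q)"
      by (simp only: qint_def power_int_minus power_int_of_nat)
    moreover have "q ^ Suc m \<noteq> 0" using assms(1) by simp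
    ultimately show ?thesis
      by (metis divide_divide_eq_right mult_divide_mult_cancel_right times_divide_eq_right)
  qed
  have coeff: "q ^ (m choose 2) / qfact q m = exp_coeff m" for m
  proof (induction m)
    case 0
    show ?case by (simp add: qfact_def numeral_2_eq_2)
  next
    case (Suc m)
    have "q ^ (Suc m choose 2) / qfact q (Suc m)
        = q ^ m / qint q (int (Suc m)) * (q ^ (m choose 2) / qfact q m)"
      by (simp add: qfact_def numeral_2_eq_2 power_add)
    then show ?case unfolding qint Suc.IH by simp
  qed
  have "qexp q scale n v = Sum_any (\<lambda>m. exp_term m v)"
    by (simp add: qexp_def coeff exp_term_def)
  also have "\<dots> = exp_sum N v"
    unfolding exp_sum_def using exp_term_eq_0 by (intro Sum_any.expand_superset) (auto simp: not_less[symmetric])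
  finally show ?thesis .
qed

lemma exp_sum_bij:
  assumes fd: "finite_dimensional_vector_space scale Basis"
  shows "bij (exp_sum N)"
proof -
  interpret fd: finite_dimensional_vector_space scale Basis by (rule fd)
  have exp_sum_add: "exp_sum N (u + v) = exp_sum N u + exp_sum N v" for u v
    by (simp add: exp_sum_def exp_term_def n_funpow_add scale_right_distrib sum.distrib)
  have exp_sum_scale: "exp_sum N (scale c v) = scale c (exp_sum N v)" for c v
    by (simp add: exp_sum_def exp_term_def n_funpow_scale scale_sum_right mult.commute)
  have lin: "Vector_Spaces.linear scale scale (exp_sum N)"
    by unfold_locales (rule exp_sum_add exp_sum_scale)+
  have "inj (exp_sum N)"
  proof (rule injI)
    fix u v assume "exp_sum N u = exp_sum N v"
    then have "exp_sum N (u - v) = 0" using additive_diff[of "exp_sum N" u v, OF exp_sum_add] by simp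
    then show "u = v" using exp_sum_kernel_trivial[of "u - v"] by simp
  qed
  then show ?thesis
    using fd.linear_inj_imp_surj[OF lin] by (simp add: bij_def)
qed

lemma exp_sum_z_eq_conj_z_exp_sum: "exp_sum N (w v + Y v) = conj_z (exp_sum N v)"
  using exp_sum_z[of N v] exp_sum_stable[of "Suc N" v] exp_sum_stable[of "Suc (Suc N)" v]
    exp_sum_stable[of "Suc (Suc N)" "w v + Y v"]
  by (simp add: exp_term_eq_0 conj_z_def)

end


end

section \<open>Three consecutive generators\<close>

text \<open>Here \<open>y_z\<close> is the linear relation for the pair \<open>y\<close>, \<open>z\<close>, now solved for \<open>y z\<close>, and \<open>x_z\<close> is the
  cubic relation with \<open>[3]\<^sub>q = p + 1 + r\<close>.\<close>

locale q_triple = q_weyl_pair scale p r x y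
  for scale :: "'f::field \<Rightarrow> 'v::ab_group_add \<Rightarrow> 'v" and p r x y +
  fixes z Y :: "'v \<Rightarrow> 'v"
  assumes z_add: "z (u + v) = z u + z v" and z_scale: "z (scale c v) = scale c (z v)"
    and y_z: "y (z v) = scale r (z (y v)) + scale (1 - r) v"
    and x_z: "x (x (x (z v))) - scale (p + 1 + r) (x (x (z (x v))))
        + scale (p + 1 + r) (x (z (x (x v)))) - z (x (x (x v))) = 0"
    and y_Y: "y (Y v) = v" and Y_y: "Y (y v) = v"
begin

text \<open>Subtracting \<open>Y\<close> from \<open>z\<close> removes the inhomogeneous term of the relation with \<open>y\<close>; see \<open>w_Y\<close>.\<close>

definition w where "w v = z v - Y v"

lemma Y_add: "Y (u + v) = Y u + Y v"
  by (metis y_add Y_y y_Y)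

lemma Y_scale: "Y (scale c v) = scale c (Y v)"
  by (metis y_scale Y_y y_Y)

lemmas Y_diff = additive_diff[of Y, OF Y_add]

lemma w_add: "w (u + v) = w u + w v"
  by (simp add: w_def z_add Y_add)

lemma w_scale: "w (scale c v) = scale c (w v)"
  by (simp add: w_def z_scale Y_scale scale_right_diff_distrib)

lemmas w_diff = additive_diff[of w, OF w_add]

lemmas n_w_Y_linear = n_add n_diff n_scale w_add w_diff w_scale Y_add Y_diff Y_scale

lemma n_Y: "n (Y v) = scale p (Y (n v))"
  using y_n[of "Y v"] by (metis y_Y Y_y Y_scale)

lemma w_Y: "w (Y v) = scale r (Y (w v))"
proof -
  have "y (w (Y v)) = scale r (w v)"
    by (simp add: w_def y_diff y_z y_Y scale_distribs)
  then show ?thesis by (metis Y_y Y_scale)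
qed

lemma x_Y: "x v = Y v - scale (p - 1) (Y (n v))"
  by (metis yx_n Y_y Y_diff Y_scale)

lemma z_Y: "z v = w v + Y v"
  by (simp add: w_def)

text \<open>With \<open>x = Y - (p - 1) Y n\<close> and \<open>z = w + Y\<close> all copies of \<open>Y\<close> can be collected on the left.
  In the result the terms of degree less than three in \<open>n\<close> with a \<open>w\<close> cancel, and so do all terms without a \<open>w\<close>
  except \<open>Y n\<^sup>2\<close>.  The factor comes from the leading term of \<open>x\<^sup>3 z\<close>.\<close>

lemma x_z_expanded:
  "x (x (x (z v))) - scale (p + 1 + r) (x (x (z (x v))))
        + scale (p + 1 + r) (x (z (x (x v)))) - z (x (x (x v)))
   = scale (- (((p - 1) * p) ^ 3))
       (Y (Y (Y (n (n (n (w v))) - scale (1 + r + r * r) (n (n (w (n v))))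
         + scale (r + r * r + r * (r * r)) (n (w (n (n v))))
         - scale (r * (r * r)) (w (n (n (n v)))) - scale \<kappa> (Y (n (n v)))))))"
  \<comment> \<open>The first step turns both sides into sums of words in \<open>Y\<close>, \<open>n\<close>, \<open>w\<close>, with \<open>Y\<close> in front,
    whose coefficients are monomials in \<open>p\<close> and \<open>r\<close> times numerals; the second writes the numeral
    multiples as repeated summands.\<close>
  by (simp add: x_Y z_Y \<kappa>_def n_w_Y_linear n_Y w_Y scale_distribs power3_eq_cube algebra_simps pr)
     (simp only: numeral_multiples distrib_left scale_left_distrib add_ac)

lemma serre:
  "n (n (n (w v))) - scale (1 + r + r * r) (n (n (w (n v))))
      + scale (r + r * r + r * (r * r)) (n (w (n (n v)))) - scale (r * (r * r)) (w (n (n (n v))))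
      = scale \<kappa> (Y (n (n v)))" (is "?s = ?t")
proof -
  have "scale (- (((p - 1) * p) ^ 3)) (Y (Y (Y (?s - ?t)))) = 0"
    by (simp only: x_z_expanded [symmetric] x_z)
  then have "Y (Y (Y (?s - ?t))) = 0" using p_1 p_nonzero by simp
  then have "?s - ?t = 0" by (metis y_Y y_scale scale_zero_left)
  then show ?thesis by simp
qed

lemma w_y: "w (y v) = scale p (y (w v))"
  by (metis w_Y y_Y Y_y Y_scale scale_scale r scale_one y_scale)

sublocale q_serre_pair scale p r n w Y
  by unfold_locales (rule n_add n_scale w_add w_scale Y_add Y_scale n_Y serre)+

text \<open>The operators \<open>y\<close> on the right cancel the \<open>Y\<close> contained in each \<open>x\<close>, since \<open>y\<close> scales past \<open>n\<close> and \<open>w\<close>.\<close>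

lemma conj_z_eq:
  "conj_z v = z v - Y v + scale (p / (p - 1)) (z (x (y v))) - scale (1 / (p - 1)) (x (z (y v)))
     + scale (p ^ 3 / ((p - 1) * (p ^ 2 - 1))) (z (x (x (y (y v)))))
     + scale (p ^ 2 / ((p - 1) * (p ^ 2 - 1))) (x (x (z (y (y v)))))
     - scale (p ^ 2 / (p - 1) ^ 2) (x (z (x (y (y v)))))" (is "_ = ?G")
proof -
  \<comment> \<open>Multiplication by the common denominator makes every coefficient a polynomial in \<open>p\<close> and \<open>r\<close>,
    so that both sides can be expanded into words in \<open>Y\<close>, \<open>n\<close>, \<open>w\<close> and compared.\<close>
  define D where "D = (p - 1) ^ 2 * (p + 1)"
  have D: "D \<noteq> 0" using p_1 p_plus_1 by (simp add: D_def)
  have p2: "p ^ 2 - 1 = (p - 1) * (p + 1)" by (simp add: algebra_simps power2_eq_square)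
  have c: "D * c2 = p * (p - 1) * (p - 1)"
    "D * (p / (p - 1)) = p * (p - 1) * (p + 1)"
    "D * (1 / (p - 1)) = (p - 1) * (p + 1)"
    "D * (p ^ 3 / ((p - 1) * (p ^ 2 - 1))) = p * p * p"
    "D * (p ^ 2 / ((p - 1) * (p ^ 2 - 1))) = p * p"
    "D * (p ^ 2 / (p - 1) ^ 2) = p * p * (p + 1)"
    unfolding p2 using p_1 p_plus_1
    by (simp_all add: D_def c2_def divide_simps power2_eq_square power3_eq_cube)
  have "scale D (conj_z v) =
      scale ((p - 1) * (p - 1) * (p + 1)) (w v + ad1 v + Y (v + scale (p - 1) (n v)))
      + scale (p * (p - 1) * (p - 1)) (ad2 v)"
    unfolding conj_z_def scale_distribs scale_scale c by (simp add: D_def power2_eq_square ac_simps)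
  also have "\<dots> = scale ((p - 1) * (p - 1) * (p + 1)) (z v - Y v)
     + scale (p * (p - 1) * (p + 1)) (z (x (y v))) - scale ((p - 1) * (p + 1)) (x (z (y v)))
     + scale (p * p * p) (z (x (x (y (y v)))))
     + scale (p * p) (x (x (z (y (y v)))))
     - scale (p * p * (p + 1)) (x (z (x (y (y v)))))"
    by (simp add: x_Y z_Y ad2_def ad1_def n_w_Y_linear n_Y w_Y n_y w_y Y_y y_Y y_add y_diff y_scale
        scale_distribs algebra_simps pr)
     (simp only: numeral_multiples distrib_left scale_left_distrib add_ac)
  also have "\<dots> = scale D ?G"
    unfolding scale_right_distrib scale_right_diff_distrib scale_scale c
    by (simp add: D_def power2_eq_square)
  finally show ?thesis using D by simp
qed

end

section \<open>Modules over the presented algebra\<close>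

lemma free_ring_simps:
  "carrier free_ring = UNIV" "a \<oplus>\<^bsub>free_ring\<^esub> b = a + b" "a \<otimes>\<^bsub>free_ring\<^esub> b = a * b"
  "\<one>\<^bsub>free_ring\<^esub> = 1" "\<zero>\<^bsub>free_ring\<^esub> = 0"
  by (simp_all add: ring_of_type_algebra_def)

text \<open>This commutation is what makes the generators act linearly over the field.\<close>

lemma free_scalar_mult_gen: "free_gen i * free_scalar c = free_scalar c * free_gen i"
  by (simp add: free_gen_def free_scalar_def mult_single plus_list_def)

lemma box_ideal_is_ideal: "ideal (box_ideal q) free_ring"
  unfolding box_ideal_def
  by (rule ring.genideal_ideal[OF ring_free_ring]) (simp add: free_ring_simps)

lemma box_relators_subset: "box_relators q \<subseteq> box_ideal q"
  unfolding box_ideal_def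
  by (rule ring.genideal_self[OF ring_free_ring]) (simp add: free_ring_simps)

context box_module
begin

text \<open>The pullback of the module structure to the free algebra, where the relators can be evaluated
  term by term.\<close>

definition rep :: "'f free_alg \<Rightarrow> 'v \<Rightarrow> 'v" where
  "rep a = act (box_ideal q +>\<^bsub>free_ring\<^esub> a)"

lemma coset_hom: "(+>\<^bsub>free_ring\<^esub>) (box_ideal q) \<in> ring_hom free_ring (box_algebra q)"
  unfolding box_algebra_def by (rule ideal.rcos_ring_hom[OF box_ideal_is_ideal])

lemma coset_closed: "box_ideal q +>\<^bsub>free_ring\<^esub> a \<in> carrier (box_algebra q)"
  using ring_hom_closed[OF coset_hom, of a] by (simp add: free_ring_simps)

lemma rep_add: "rep (a + b) v = rep a v + rep b v"
  using ring_hom_add[OF coset_hom, of a b]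
  by (simp add: free_ring_simps rep_def act_add_left coset_closed)

lemma rep_mult: "rep (a * b) v = rep a (rep b v)"
  using ring_hom_mult[OF coset_hom, of a b]
  by (simp add: free_ring_simps rep_def act_mult coset_closed)

lemma rep_one: "rep 1 v = v"
  using ring_hom_one[OF coset_hom] by (simp add: free_ring_simps rep_def act_one)

lemma rep_diff: "rep (a - b) v = rep a v - rep b v"
  using rep_add[of "a - b" b v] by (simp add: algebra_simps)

lemma rep_scalar: "rep (free_scalar c) v = scale c v"
  using act_scalar by (simp add: rep_def box_scalar_def)

lemma rep_relator:
  assumes "a \<in> box_relators q"
  shows "rep a v = 0"
proof -
  interpret I: ideal "box_ideal q" free_ring by (rule box_ideal_is_ideal)
  have "a \<in> box_ideal q" "0 \<in> box_ideal q"
    using assms box_relators_subset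
      additive_subgroup.zero_closed[OF I.is_additive_subgroup, unfolded free_ring_simps] by blast+
  then have "box_ideal q +>\<^bsub>free_ring\<^esub> a = box_ideal q +>\<^bsub>free_ring\<^esub> 0"
    by (simp add: I.a_rcos_const)
  then have "rep a v = rep 0 v" by (simp add: rep_def)
  then show ?thesis using rep_add[of 0 0 v] by simp
qed

definition gen_act where "gen_act i = act (box_gen q i)"

lemma rep_gen: "rep (free_gen i) = gen_act i"
  by (simp add: rep_def gen_act_def box_gen_def)

lemma gen_act_add: "gen_act i (u + v) = gen_act i u + gen_act i v"
  unfolding rep_gen[symmetric] rep_def by (rule act_add_right[OF coset_closed])

lemma gen_act_scale: "gen_act i (scale c v) = scale c (gen_act i v)"
  by (metis free_scalar_mult_gen rep_mult rep_gen rep_scalar)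

lemma gen_act_weyl:
  "scale (1 / (q - inverse q)) (scale q (gen_act i (gen_act (i + 1) v))
     - scale (inverse q) (gen_act (i + 1) (gen_act i v))) = v"
proof -
  have "free_scalar (1 / (q - inverse q)) *
               (free_scalar q * free_gen i * free_gen (i + 1)
                - free_scalar (inverse q) * free_gen (i + 1) * free_gen i) - 1 \<in> box_relators q"
    by (simp add: box_relators_def)
  from rep_relator[OF this, of v] show ?thesis
    by (simp add: rep_diff rep_mult rep_scalar rep_gen rep_one)
qed

lemma gen_act_serre:
  "gen_act i (gen_act i (gen_act i (gen_act (i + 2) v)))
    - scale (qint q 3) (gen_act i (gen_act i (gen_act (i + 2) (gen_act i v))))
    + scale (qint q 3) (gen_act i (gen_act (i + 2) (gen_act i (gen_act i v))))
    - gen_act (i + 2) (gen_act i (gen_act i (gen_act i v))) = 0"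
proof -
  have "free_gen i ^ 3 * free_gen (i + 2)
               - free_scalar (qint q 3) * free_gen i ^ 2 * free_gen (i + 2) * free_gen i
               + free_scalar (qint q 3) * free_gen i * free_gen (i + 2) * free_gen i ^ 2
               - free_gen (i + 2) * free_gen i ^ 3 \<in> box_relators q"
    by (simp add: box_relators_def)
  from rep_relator[OF this, of v] show ?thesis
    by (simp add: rep_diff rep_add rep_mult rep_scalar rep_gen rep_one power2_eq_square power3_eq_cube)
qed

text \<open>Subtraction in the quotient ring is a derived operation and is reduced to addition by cancellation.\<close>

lemma act_minus:
  assumes "a \<in> carrier (box_algebra q)" "b \<in> carrier (box_algebra q)"
  shows "act (a \<ominus>\<^bsub>box_algebra q\<^esub> b) v = act a v - act b v"
proof -
  interpret R: ring "box_algebra q"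
    unfolding box_algebra_def by (rule ideal.quotient_is_ring[OF box_ideal_is_ideal])
  have "(a \<ominus>\<^bsub>box_algebra q\<^esub> b) \<oplus>\<^bsub>box_algebra q\<^esub> b = a"
    using assms by algebra
  then show ?thesis
    using act_add_left[of "a \<ominus>\<^bsub>box_algebra q\<^esub> b" b v] assms by (simp add: algebra_simps)
qed

lemma act_box_n: "act (box_n q i) v = scale (q / (q - inverse q)) (v - gen_act i (gen_act (i + 1) v))"
proof -
  interpret R: ring "box_algebra q"
    unfolding box_algebra_def by (rule ideal.quotient_is_ring[OF box_ideal_is_ideal])
  have "box_gen q j \<in> carrier (box_algebra q)" "box_scalar q c \<in> carrier (box_algebra q)" for j c
    by (simp_all add: box_gen_def box_scalar_def coset_closed)
  then show ?thesis
    by (simp add: box_n_def act_mult act_minus act_scalar act_one gen_act_def)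
qed

end

theorem theorem9p6:
  fixes q :: "'f::alg_closed_field"
    and scale :: "'f \<Rightarrow> 'v::ab_group_add \<Rightarrow> 'v"
    and Basis :: "'v set"
    and act :: "'f free_alg set \<Rightarrow> 'v \<Rightarrow> 'v"
    and i :: 4
  assumes q_nonzero: "q \<noteq> 0"
    and q_not_root_of_unity: "\<And>n::nat. n > 0 \<Longrightarrow> q ^ n \<noteq> 1"
    and module: "box_module scale q act"
    and finite_dim: "finite_dimensional_vector_space scale Basis"
    and nonzero: "\<exists>v::'v. v \<noteq> 0"
  shows
    "let x = (\<lambda>j. act (box_gen q j));
         E = qexp q scale (act (box_n q i))
     in E \<circ> x (i + 2) \<circ> inv_into UNIV E =
        (\<lambda>v. x (i + 2) v - inv_into UNIV (x (i + 1)) v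
           + scale (q / (q - inverse q)) (x (i + 2) (x i (x (i + 1) v)))
           - scale (1 / (q * (q - inverse q))) (x i (x (i + 2) (x (i + 1) v)))
           + scale (q ^ 3 / ((q - inverse q) * (q ^ 2 - inverse (q ^ 2))))
               (x (i + 2) ((x i ^^ 2) ((x (i + 1) ^^ 2) v)))
           + scale (q / ((q - inverse q) * (q ^ 2 - inverse (q ^ 2))))
               ((x i ^^ 2) (x (i + 2) ((x (i + 1) ^^ 2) v)))
           - scale (q ^ 2 / (q - inverse q) ^ 2)
               (x i (x (i + 2) (x i ((x (i + 1) ^^ 2) v)))))"
proof -
  interpret M: box_module scale q act by (rule module)
  define p r where "p = q ^ 2" and "r = inverse p"
  have p: "p \<noteq> 0" "p * r = 1" using q_nonzero by (simp_all add: p_def r_def)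
  have r: "inverse q * inverse q = r" by (simp add: p_def r_def power2_eq_square)
  have p_nru: "p ^ k \<noteq> 1" if "k > 0" for k :: nat
    using q_not_root_of_unity[of "2 * k"] that by (simp add: p_def power_mult)
  have q2: "q * q \<noteq> 1" using q_not_root_of_unity[of 2] by (simp add: power2_eq_square)
  have d: "q - inverse q \<noteq> 0" using q_nonzero q2 by (simp add: field_simps)
  have weyl: "M.gen_act j (M.gen_act (j + 1) v)
      = scale r (M.gen_act (j + 1) (M.gen_act j v)) + scale (1 - r) v" for j v
  proof -
    let ?a = "M.gen_act j (M.gen_act (j + 1) v)" and ?b = "M.gen_act (j + 1) (M.gen_act j v)"
    have "scale (q - inverse q) v = scale q ?a - scale (inverse q) ?b"
      using arg_cong[OF M.gen_act_weyl[of j v], of "scale (q - inverse q)"] d by simp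
    then have "scale (inverse q) (scale (q - inverse q) v)
        = scale (inverse q) (scale q ?a - scale (inverse q) ?b)"
      by simp
    then have "scale (1 - r) v = ?a - scale r ?b"
      using q_nonzero r by (simp add: M.scale_right_diff_distrib right_diff_distrib)
    then show ?thesis by simp
  qed
  have qint3: "qint q 3 = p + 1 + r"
  proof -
    have "q powi 3 - q powi (- 3) = (p + 1 + r) * (q - inverse q)"
      using q_nonzero
      by (simp add: p_def r_def power_int_minus power2_eq_square power3_eq_cube field_simps)
    then show ?thesis using d by (simp add: qint_def)
  qed
  have i2: "i + 1 + 1 = i + 2" by (simp add: add.assoc)
  interpret W: q_weyl_pair scale p r "M.gen_act i" "M.gen_act (i + 1)"
    by unfold_locales (rule p p_nru M.gen_act_add M.gen_act_scale weyl | assumption)+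
  have y_bij: "bij (M.gen_act (i + 1))" by (rule W.y_bij[OF finite_dim])
  define Y where "Y = inv_into UNIV (M.gen_act (i + 1))"
  interpret T: q_triple scale p r "M.gen_act i" "M.gen_act (i + 1)" "M.gen_act (i + 2)" Y
  proof unfold_locales
    show "M.gen_act (i + 1) (M.gen_act (i + 2) v)
        = scale r (M.gen_act (i + 2) (M.gen_act (i + 1) v)) + scale (1 - r) v" for v
      using weyl[of "i + 1" v] by (simp only: i2)
    show "M.gen_act (i + 1) (Y v) = v" "Y (M.gen_act (i + 1) v) = v" for v
      using y_bij by (simp_all add: Y_def surj_f_inv_f bij_is_surj inv_f_f bij_is_inj)
  qed (use M.gen_act_serre[of i] in \<open>simp_all add: M.gen_act_add M.gen_act_scale qint3\<close>)
  obtain N where N: "\<And>v. (W.n ^^ N) v = 0" using W.n_nilpotent[OF finite_dim] by blast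
  have "q / (q - inverse q) = p / (p - 1)"
    using q_nonzero by (simp add: p_def divide_simps power2_eq_square)
  then have "act (box_n q i) = W.n" by (simp add: fun_eq_iff M.act_box_n W.n_def)
  then have E: "qexp q scale (act (box_n q i)) = T.exp_sum N"
    using T.qexp_eq_exp_sum[OF N q_nonzero p_def] by auto
  have E_bij: "bij (T.exp_sum N)" by (rule T.exp_sum_bij[OF N finite_dim])
  have conj: "(T.exp_sum N \<circ> M.gen_act (i + 2) \<circ> inv_into UNIV (T.exp_sum N)) v = T.conj_z v" for v
  proof -
    have "T.exp_sum N (M.gen_act (i + 2) u) = T.conj_z (T.exp_sum N u)" for u
      using T.exp_sum_z_eq_conj_z_exp_sum[OF N, of u] by (simp add: T.w_def)
    then show ?thesis using E_bij by (simp add: surj_f_inv_f bij_is_surj)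
  qed
  have q_eq: "q - inverse q = (p - 1) / q"
    using q_nonzero by (simp add: p_def field_simps power2_eq_square)
  have q2_eq: "q ^ 2 - inverse (q ^ 2) = (p ^ 2 - 1) / p"
    using p(1) unfolding p_def[symmetric] by (simp add: field_simps power2_eq_square)
  have coeffs: "q / (q - inverse q) = p / (p - 1)" "1 / (q * (q - inverse q)) = 1 / (p - 1)"
    "q ^ 3 / ((q - inverse q) * (q ^ 2 - inverse (q ^ 2))) = p ^ 3 / ((p - 1) * (p ^ 2 - 1))"
    "q / ((q - inverse q) * (q ^ 2 - inverse (q ^ 2))) = p ^ 2 / ((p - 1) * (p ^ 2 - 1))"
    "q ^ 2 / (q - inverse q) ^ 2 = p ^ 2 / (p - 1) ^ 2"
    unfolding q_eq q2_eq using q_nonzero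
    by (simp_all add: p_def power2_eq_square power3_eq_cube power_divide)
  show ?thesis
    unfolding Let_def coeffs E M.gen_act_def[symmetric] Y_def[symmetric] fun_eq_iff conj T.conj_z_eq
    by (simp add: numeral_2_eq_2)
qed

end
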